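(* Let $n\ge 2$ and $d=n(n-1)/2$. For every $x\in[0,1]$, $$ \operatorname{Vol}\{C\in\mathcal{E}_n:\lambda_{\min}(C)\geq x\}=(1-x)^{d}\,\operatorname{Vol}(\mathcal{E}_n), $$ where $\lambda_{\min}(C)$ denotes the smallest eigenvalue of $C$.
   Context: $\mathcal{E}_n=\{C\in\mathbb{R}^{n\times n}: C=C',\ C\succeq 0,\ C_{ii}=1 \text{ for all } i\}$ is the set of $n\times n$ correlation matrices (the elliptope). It is identified with a subset of $[-1,1]^d\subset\mathbb{R}^d$ via the off-diagonal coordinates $(C_{ij})_{i<j}$, and $\operatorname{Vol}$ denotes $d$-dimensional Lebesgue measure in these coordinates. *)

theory Defs
  imports
    "HOL-Analysis.Analysis"
    "Jordan_Normal_Form.Spectral_Radius"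
begin

unbundle no inner_syntax

definition positive_semidefinite :: "nat \<Rightarrow> real mat \<Rightarrow> bool" where
  "positive_semidefinite n C \<longleftrightarrow>
     C \<in> carrier_mat n n \<and> (\<forall>v \<in> carrier_vec n. v \<bullet> (C *\<^sub>v v) \<ge> 0)"

definition elliptope :: "nat \<Rightarrow> real mat set" where
  "elliptope n = {C \<in> carrier_mat n n.
     transpose_mat C = C \<and> positive_semidefinite n C \<and> (\<forall>i<n. C $$ (i, i) = 1)}"

text \<open>Only meaningful for matrices with a nonempty finite set of real eigenvalues,
  such as real symmetric matrices of positive dimension.\<close>

definition min_eigenvalue :: "real mat \<Rightarrow> real" where
  "min_eigenvalue C = Min (spectrum C)"

text \<open>Rows and columns are indexed from 0, so the coordinates of an \<open>n \<times> n\<close> correlation matrix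
  are indexed by the \<open>n * (n - 1) div 2\<close> pairs below.\<close>

definition offdiag_index :: "nat \<Rightarrow> (nat \<times> nat) set" where
  "offdiag_index n = {(i, j). i < j \<and> j < n}"

definition offdiag_coords :: "nat \<Rightarrow> real mat \<Rightarrow> nat \<times> nat \<Rightarrow> real" where
  "offdiag_coords n C = (\<lambda>p \<in> offdiag_index n. C $$ p)"

text \<open>The completed product of the one-dimensional Borel--Lebesgue measures is Lebesgue measure
  on the real functions indexed by \<open>offdiag_index n\<close>.\<close>

definition Vol :: "nat \<Rightarrow> real mat set \<Rightarrow> ennreal" where
  "Vol n S = emeasure (completion (Pi\<^sub>M (offdiag_index n) (\<lambda>_. lborel))) (offdiag_coords n ` S)"

end

theory Submission
  imports Defs
begin

text \<open>By the variational characterisation of the smallest eigenvalue, \<open>\<lambda>\<^sub>m\<^sub>i\<^sub>n C \<ge> x\<close> means that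
  \<open>C - x I\<close> is positive semidefinite. For \<open>x < 1\<close> this says \<open>C = (1 - x) D + x I\<close> with \<open>D\<close> again a
  correlation matrix, so in off-diagonal coordinates the set is the elliptope scaled by \<open>1 - x\<close>.
  The variational characterisation is obtained without the spectral theorem: if \<open>m\<close> is the largest
  number with \<open>A - m I\<close> positive semidefinite, then \<open>A - m I\<close> is singular, since a nonsingular
  positive semidefinite matrix dominates some \<open>e I\<close> with \<open>e > 0\<close>.\<close>

section \<open>The smallest eigenvalue and the quadratic form\<close>

lemma scalar_prod_self_nonneg: "(v :: real vec) \<bullet> v \<ge> 0"
  unfolding scalar_prod_def by (simp add: sum_nonneg)

lemma scalar_prod_self_pos:
  assumes "v \<in> carrier_vec n" "v \<noteq> 0\<^sub>v n"
  shows "(v :: real vec) \<bullet> v > 0"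
proof -
  obtain i where i: "i < n" "v $ i \<noteq> 0"
    using assms by (metis carrier_vecD eq_vecI index_zero_vec)
  have "0 < v $ i * v $ i"
    using i(2) by (auto simp: zero_less_mult_iff)
  also have "\<dots> \<le> (\<Sum>j\<in>{0..<dim_vec v}. v $ j * v $ j)"
    using i assms by (intro member_le_sum) auto
  finally show ?thesis unfolding scalar_prod_def .
qed

lemma mult_mat_vec_norm_bound:
  fixes A :: "real mat"
  assumes A: "A \<in> carrier_mat m n"
  obtains K where "K > 0" "\<And>v. v \<in> carrier_vec n \<Longrightarrow> (A *\<^sub>v v) \<bullet> (A *\<^sub>v v) \<le> K * (v \<bullet> v)"
proof
  define K where "K = (\<Sum>i\<in>{0..<m}. \<Sum>j\<in>{0..<n}. (A $$ (i, j))\<^sup>2)"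
  have "K \<ge> 0" unfolding K_def by (intro sum_nonneg) auto
  \<comment> \<open>\<open>K\<close> is the squared Frobenius norm, which is zero for the zero
    matrix. Adding 1 makes the constant positive, so that it can be divided by later.\<close>
  then show "K + 1 > 0" by simp
  fix v :: "real vec" assume v: "v \<in> carrier_vec n"
  have "(A *\<^sub>v v) \<bullet> (A *\<^sub>v v) = (\<Sum>i\<in>{0..<m}. (\<Sum>j\<in>{0..<n}. A $$ (i, j) * v $ j)\<^sup>2)"
    using A v by (auto simp: scalar_prod_def power2_eq_square intro!: sum.cong)
  also have "\<dots> \<le> (\<Sum>i\<in>{0..<m}. (\<Sum>j\<in>{0..<n}. (A $$ (i, j))\<^sup>2) * (\<Sum>j\<in>{0..<n}. (v $ j)\<^sup>2))"
    by (intro sum_mono Cauchy_Schwarz_ineq_sum)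
  also have "\<dots> = K * (v \<bullet> v)"
    using v by (simp add: K_def scalar_prod_def sum_distrib_right power2_eq_square)
  also have "\<dots> \<le> (K + 1) * (v \<bullet> v)"
    using scalar_prod_self_nonneg[of v] by (simp add: distrib_right)
  finally show "(A *\<^sub>v v) \<bullet> (A *\<^sub>v v) \<le> (K + 1) * (v \<bullet> v)" .
qed

lemma scalar_prod_symmetric_mat:
  fixes A :: "real mat"
  assumes "A \<in> carrier_mat n n" "transpose_mat A = A" "u \<in> carrier_vec n" "v \<in> carrier_vec n"
  shows "u \<bullet> (A *\<^sub>v v) = (A *\<^sub>v u) \<bullet> v"
  using transpose_vec_mult_scalar[OF assms(1) assms(4) assms(3)] assms(2) by simp

text \<open>Summing |ab| <= a^2 + b^2 over the coordinates reduces this to the bound on the norm of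
  \<open>A *\<^sub>v v\<close>. The constant is far from sharp; only its existence matters.\<close>

lemma quadratic_form_bound:
  fixes A :: "real mat"
  assumes A: "A \<in> carrier_mat n n"
  obtains L where "L > 0" "\<And>v. v \<in> carrier_vec n \<Longrightarrow> \<bar>v \<bullet> (A *\<^sub>v v)\<bar> \<le> L * (v \<bullet> v)"
proof -
  obtain K where K: "K > 0" "\<And>v. v \<in> carrier_vec n \<Longrightarrow> (A *\<^sub>v v) \<bullet> (A *\<^sub>v v) \<le> K * (v \<bullet> v)"
    using mult_mat_vec_norm_bound[OF A] by blast
  show thesis
  proof
    show "1 + K > 0" using K(1) by simp
    fix v :: "real vec" assume v: "v \<in> carrier_vec n"
    let ?w = "A *\<^sub>v v"
    have w: "?w \<in> carrier_vec n" using A v by simp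
    have "\<bar>v \<bullet> ?w\<bar> \<le> (\<Sum>i\<in>{0..<n}. \<bar>v $ i * ?w $ i\<bar>)"
      unfolding scalar_prod_def carrier_vecD[OF w] by (rule sum_abs)
    also have "\<dots> \<le> (\<Sum>i\<in>{0..<n}. v $ i * v $ i + ?w $ i * ?w $ i)"
    proof (rule sum_mono)
      fix i
      have "2 * \<bar>a * b\<bar> \<le> a * a + b * b" for a b :: real
        using sum_squares_bound[of "\<bar>a\<bar>" "\<bar>b\<bar>"] by (simp add: abs_mult power2_eq_square)
      from this[of "v $ i" "?w $ i"] show "\<bar>v $ i * ?w $ i\<bar> \<le> v $ i * v $ i + ?w $ i * ?w $ i"
        by linarith
    qed
    also have "\<dots> = v \<bullet> v + ?w \<bullet> ?w"
      unfolding scalar_prod_def carrier_vecD[OF v] carrier_vecD[OF w] by (rule sum.distrib)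
    also have "\<dots> \<le> (1 + K) * (v \<bullet> v)"
      using K(2)[OF v] by (simp add: distrib_right)
    finally show "\<bar>v \<bullet> ?w\<bar> \<le> (1 + K) * (v \<bullet> v)" .
  qed
qed

text \<open>The form at the shifted point \<open>u\<close> is nonnegative, and by symmetry and the
  bound \<open>L\<close> it is at most \<open>v \<bullet> w - (w \<bullet> w) / L\<close>, where
  \<open>w = A *\<^sub>v v\<close>. This plays the role of the operator inequality A^2 <= L A
  without diagonalising \<open>A\<close>.\<close>

lemma psd_norm_mult_le:
  fixes A :: "real mat"
  assumes A: "A \<in> carrier_mat n n" and sym: "transpose_mat A = A"
    and psd: "\<And>v. v \<in> carrier_vec n \<Longrightarrow> 0 \<le> v \<bullet> (A *\<^sub>v v)"
    and L: "L > 0" "\<And>v. v \<in> carrier_vec n \<Longrightarrow> \<bar>v \<bullet> (A *\<^sub>v v)\<bar> \<le> L * (v \<bullet> v)"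
    and v: "v \<in> carrier_vec n"
  shows "(A *\<^sub>v v) \<bullet> (A *\<^sub>v v) \<le> L * (v \<bullet> (A *\<^sub>v v))"
proof -
  \<comment> \<open>evaluate the form at the point reached from \<open>v\<close> by a gradient step of length \<open>1 / L\<close>\<close>
  define w where "w = A *\<^sub>v v"
  define u where "u = v - (1 / L) \<cdot>\<^sub>v w"
  have w: "w \<in> carrier_vec n" and Aw: "A *\<^sub>v w \<in> carrier_vec n"
    using A v by (auto simp: w_def)
  have Au: "A *\<^sub>v u = w - (1 / L) \<cdot>\<^sub>v (A *\<^sub>v w)"
    unfolding u_def using A v w by (simp add: mult_minus_distrib_mat_vec mult_mat_vec w_def)
  have "v \<bullet> (A *\<^sub>v w) = w \<bullet> w"
    using scalar_prod_symmetric_mat[OF A sym v w] by (simp add: w_def)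
  then have "u \<bullet> (A *\<^sub>v u) = v \<bullet> w - 2 / L * (w \<bullet> w) + (1 / L)\<^sup>2 * (w \<bullet> (A *\<^sub>v w))"
    unfolding Au unfolding u_def using v w Aw
    by (simp add: scalar_prod_minus_distrib[of _ n] minus_scalar_prod_distrib[of _ n] power2_eq_square
        algebra_simps)
  also have "\<dots> \<le> v \<bullet> w - 2 / L * (w \<bullet> w) + (1 / L)\<^sup>2 * (L * (w \<bullet> w))"
    using L(2)[OF w] by (intro add_left_mono mult_left_mono) auto
  also have "\<dots> = v \<bullet> w - (w \<bullet> w) / L"
    using L(1) by (simp add: power2_eq_square field_simps)
  finally have "0 \<le> v \<bullet> w - (w \<bullet> w) / L"
    using psd[of u] v w by (simp add: u_def)
  then show ?thesis
    using L(1) by (simp add: w_def field_simps)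
qed

text \<open>With a left inverse \<open>B\<close>, the vector
  \<open>v = B *\<^sub>v (A *\<^sub>v v)\<close> is bounded in norm by \<open>A *\<^sub>v v\<close>,
  whose squared norm is in turn bounded by \<open>L\<close> times the form. No compactness of the
  unit sphere enters.\<close>

lemma psd_nonsingular_coercive:
  fixes A :: "real mat"
  assumes A: "A \<in> carrier_mat n n" and sym: "transpose_mat A = A"
    and psd: "\<And>v. v \<in> carrier_vec n \<Longrightarrow> 0 \<le> v \<bullet> (A *\<^sub>v v)"
    and det: "Determinant.det A \<noteq> 0"
  obtains e where "e > 0" "\<And>v. v \<in> carrier_vec n \<Longrightarrow> e * (v \<bullet> v) \<le> v \<bullet> (A *\<^sub>v v)"
proof -
  obtain B where B: "B \<in> carrier_mat n n" "B * A = 1\<^sub>m n"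
    using det_non_zero_imp_unit[OF A det, of "()"] by (auto simp: Units_def ring_mat_def)
  obtain K where K: "K > 0" "\<And>v. v \<in> carrier_vec n \<Longrightarrow> (B *\<^sub>v v) \<bullet> (B *\<^sub>v v) \<le> K * (v \<bullet> v)"
    using mult_mat_vec_norm_bound[OF B(1)] by blast
  obtain L where L: "L > 0" "\<And>v. v \<in> carrier_vec n \<Longrightarrow> \<bar>v \<bullet> (A *\<^sub>v v)\<bar> \<le> L * (v \<bullet> v)"
    using quadratic_form_bound[OF A] by blast
  show thesis
  proof
    show "1 / (K * L) > 0" using K L by simp
    fix v :: "real vec" assume v: "v \<in> carrier_vec n"
    have "B *\<^sub>v (A *\<^sub>v v) = v"
      using assoc_mult_mat_vec[OF B(1) A v] B(2) v by simp
    then have "v \<bullet> v \<le> K * ((A *\<^sub>v v) \<bullet> (A *\<^sub>v v))"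
      using K(2)[of "A *\<^sub>v v"] A v by simp
    also have "\<dots> \<le> K * (L * (v \<bullet> (A *\<^sub>v v)))"
      using psd_norm_mult_le[OF A sym psd L v] K(1) by (intro mult_left_mono) auto
    finally show "1 / (K * L) * (v \<bullet> v) \<le> v \<bullet> (A *\<^sub>v v)"
      using K(1) L(1) by (simp add: field_simps)
  qed
qed

section \<open>The least eigenvalue as the best lower bound of the quadratic form\<close>

lemma scalar_prod_char_matrix:
  fixes A :: "real mat"
  assumes "A \<in> carrier_mat n n" "v \<in> carrier_vec n"
  shows "v \<bullet> (char_matrix A t *\<^sub>v v) = v \<bullet> (A *\<^sub>v v) - t * (v \<bullet> v)"
proof -
  have "char_matrix A t *\<^sub>v v = A *\<^sub>v v - t \<cdot>\<^sub>v v"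
    using assms by (intro eq_vecI) (auto simp: char_matrix_def add_scalar_prod_distrib[of _ n])
  then show ?thesis
    using assms by (simp add: scalar_prod_minus_distrib[of _ n])
qed

lemma symmetric_char_matrix:
  assumes "A \<in> carrier_mat n n" "transpose_mat A = A"
  shows "transpose_mat (char_matrix A t) = char_matrix A t"
proof -
  have "A $$ (i, j) = A $$ (j, i)" if "i < n" "j < n" for i j
    using assms that by (metis carrier_matD index_transpose_mat(1))
  with assms show ?thesis
    by (intro eq_matI) (auto simp: char_matrix_def)
qed

text \<open>The supremum \<open>m\<close> of the lower bounds \<open>T\<close> is itself a lower
  bound. If it were not an eigenvalue, coercivity of the shifted matrix would leave room for the
  larger lower bound \<open>m + e\<close>.\<close>

lemma symmetric_least_eigenvalue:
  fixes A :: "real mat"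
  assumes A: "A \<in> carrier_mat n n" and sym: "transpose_mat A = A" and n: "n > 0"
  obtains m where "eigenvalue A m" "\<And>v. v \<in> carrier_vec n \<Longrightarrow> m * (v \<bullet> v) \<le> v \<bullet> (A *\<^sub>v v)"
proof
  define T where "T = {t. \<forall>v\<in>carrier_vec n. t * (v \<bullet> v) \<le> v \<bullet> (A *\<^sub>v v)}"
  obtain L where L: "\<And>v. v \<in> carrier_vec n \<Longrightarrow> \<bar>v \<bullet> (A *\<^sub>v v)\<bar> \<le> L * (v \<bullet> v)"
    using quadratic_form_bound[OF A] by blast
  have "- L \<in> T"
    unfolding T_def using L by fastforce
  then have ne: "T \<noteq> {}" by auto
  have ub: "t \<le> (v \<bullet> (A *\<^sub>v v)) / (v \<bullet> v)" if "t \<in> T" "v \<in> carrier_vec n" "v \<noteq> 0\<^sub>v n" for t v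
    using that scalar_prod_self_pos[of v n] by (auto simp: T_def field_simps)
  \<comment> \<open>A nonzero vector exists because \<open>n > 0\<close>; its Rayleigh quotient
    bounds \<open>T\<close> from above.\<close>
  have "unit_vec n 0 \<noteq> (0\<^sub>v n :: real vec)"
    using n by (metis index_unit_vec(2) index_zero_vec(1) zero_neq_one)
  from ub[OF _ unit_vec_carrier this] have bdd: "bdd_above T"
    by (meson bdd_aboveI)
  define m where "m = Sup T"
  show m: "m * (v \<bullet> v) \<le> v \<bullet> (A *\<^sub>v v)" if v: "v \<in> carrier_vec n" for v
  proof (cases "v = 0\<^sub>v n")
    case True
    then show ?thesis using A by simp
  next
    case False
    have "m \<le> (v \<bullet> (A *\<^sub>v v)) / (v \<bullet> v)"
      unfolding m_def using ub v False by (intro cSup_least ne)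
    then show ?thesis
      using scalar_prod_self_pos[OF v False] by (simp add: field_simps)
  qed
  show "eigenvalue A m"
  proof (rule ccontr)
    assume "\<not> eigenvalue A m"
    then have det: "Determinant.det (char_matrix A m) \<noteq> 0"
      using eigenvalue_det[OF A] by blast
    have psd: "0 \<le> v \<bullet> (char_matrix A m *\<^sub>v v)" if "v \<in> carrier_vec n" for v
      using m[OF that] scalar_prod_char_matrix[OF A that] by simp
    obtain e where e: "e > 0"
      "\<And>v. v \<in> carrier_vec n \<Longrightarrow> e * (v \<bullet> v) \<le> v \<bullet> (char_matrix A m *\<^sub>v v)"
      using psd_nonsingular_coercive[OF char_matrix_closed[OF A] symmetric_char_matrix[OF A sym] psd det]
      by blast
    have "m + e \<in> T"
      unfolding T_def using e(2) scalar_prod_char_matrix[OF A, of _ m] by (force simp: distrib_right)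
    then have "m + e \<le> m"
      unfolding m_def using bdd by (rule cSup_upper)
    with e(1) show False by simp
  qed
qed

text \<open>Testing on an eigenvector shows that every lower bound of the form is at most every
  eigenvalue. Hence the eigenvalue \<open>m\<close> that is also a lower bound must be the minimum
  of the spectrum.\<close>

lemma min_eigenvalue_ge_iff:
  assumes A: "A \<in> carrier_mat n n" and sym: "transpose_mat A = A" and n: "n > 0"
  shows "x \<le> min_eigenvalue A \<longleftrightarrow> (\<forall>v\<in>carrier_vec n. x * (v \<bullet> v) \<le> v \<bullet> (A *\<^sub>v v))"
proof -
  obtain m where m: "eigenvalue A m" "\<And>v. v \<in> carrier_vec n \<Longrightarrow> m * (v \<bullet> v) \<le> v \<bullet> (A *\<^sub>v v)"
    using symmetric_least_eigenvalue[OF A sym n] by blast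
  have lower: "x \<le> k"
    if ev: "eigenvalue A k" and q: "\<And>v. v \<in> carrier_vec n \<Longrightarrow> x * (v \<bullet> v) \<le> v \<bullet> (A *\<^sub>v v)" for x k
  proof -
    obtain v where v: "v \<in> carrier_vec n" "v \<noteq> 0\<^sub>v n" "A *\<^sub>v v = k \<cdot>\<^sub>v v"
      using ev A unfolding eigenvalue_def eigenvector_def by auto
    then have "x * (v \<bullet> v) \<le> k * (v \<bullet> v)"
      using q[of v] by simp
    then show ?thesis
      using scalar_prod_self_pos[OF v(1,2)] by simp
  qed
  have "min_eigenvalue A = m"
    unfolding min_eigenvalue_def
    using m lower card_finite_spectrum(1)[OF A] by (intro Min_eqI) (auto simp: spectrum_def)
  moreover have "x * (v \<bullet> v) \<le> v \<bullet> (A *\<^sub>v v)" if "x \<le> m" "v \<in> carrier_vec n" for v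
    using m(2)[OF that(2)] mult_right_mono[OF that(1) scalar_prod_self_nonneg[of v]] by linarith
  ultimately show ?thesis
    using lower[OF m(1)] by auto
qed

section \<open>Contraction of the elliptope towards the identity\<close>

definition contract_to_one :: "real \<Rightarrow> nat \<Rightarrow> real mat \<Rightarrow> real mat" where
  "contract_to_one x n C = (1 - x) \<cdot>\<^sub>m C + x \<cdot>\<^sub>m 1\<^sub>m n"

lemma contract_to_one_carrier [simp]:
  "C \<in> carrier_mat n n \<Longrightarrow> contract_to_one x n C \<in> carrier_mat n n"
  by (simp add: contract_to_one_def)

lemma contract_to_one_index:
  assumes "C \<in> carrier_mat n n" "i < n" "j < n"
  shows "contract_to_one x n C $$ (i, j) = (1 - x) * C $$ (i, j) + (if i = j then x else 0)"
  using assms by (simp add: contract_to_one_def)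

lemma scalar_prod_contract_to_one:
  assumes "C \<in> carrier_mat n n" "v \<in> carrier_vec n"
  shows "v \<bullet> (contract_to_one x n C *\<^sub>v v) = (1 - x) * (v \<bullet> (C *\<^sub>v v)) + x * (v \<bullet> v)"
proof -
  have "contract_to_one x n C *\<^sub>v v = (1 - x) \<cdot>\<^sub>v (C *\<^sub>v v) + x \<cdot>\<^sub>v v"
    using assms by (intro eq_vecI) (auto simp: contract_to_one_def add_scalar_prod_distrib[of _ n])
  then show ?thesis
    using assms by (simp add: scalar_prod_add_distrib[of _ n])
qed

lemma symmetric_contract_to_one:
  assumes "C \<in> carrier_mat n n" "transpose_mat C = C"
  shows "transpose_mat (contract_to_one x n C) = contract_to_one x n C"
proof -
  have "C $$ (i, j) = C $$ (j, i)" if "i < n" "j < n" for i j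
    using assms that by (metis carrier_matD index_transpose_mat(1))
  with assms show ?thesis
    by (intro eq_matI) (auto simp: contract_to_one_def)
qed

text \<open>If C = (1 - x) D + x I, then the form of C minus \<open>x * (v \<bullet> v)\<close> is
  \<open>1 - x\<close> times the form of D, so one is nonnegative exactly when the other is. The
  unit diagonal is preserved both ways.\<close>

lemma elliptope_min_eigenvalue_ge:
  assumes n: "n > 0" and x: "0 \<le> x" "x < 1"
  shows "{C \<in> elliptope n. x \<le> min_eigenvalue C} = contract_to_one x n ` elliptope n"
proof (intro equalityI subsetI)
  fix C assume "C \<in> {C \<in> elliptope n. x \<le> min_eigenvalue C}"
  then have C: "C \<in> carrier_mat n n" "transpose_mat C = C" "\<And>i. i < n \<Longrightarrow> C $$ (i, i) = 1"
    and le: "x \<le> min_eigenvalue C"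
    by (auto simp: elliptope_def)
  \<comment> \<open>the inverse of the contraction is the expansion with \<open>1 - y = 1 / (1 - x)\<close>\<close>
  define y where "y = - x / (1 - x)"
  define D where "D = contract_to_one y n C"
  have y: "1 - y = 1 / (1 - x)" "y = - x / (1 - x)"
    using x by (auto simp: y_def field_simps)
  have y': "(1 - x) * y = - x"
    using x by (simp add: y(2))
  have D: "D \<in> carrier_mat n n" "transpose_mat D = D"
    using C by (auto simp: D_def symmetric_contract_to_one)
  have "0 \<le> v \<bullet> (D *\<^sub>v v)" if v: "v \<in> carrier_vec n" for v
  proof -
    have "x * (v \<bullet> v) \<le> v \<bullet> (C *\<^sub>v v)"
      using min_eigenvalue_ge_iff[OF C(1,2) n] le v by blast
    moreover have "v \<bullet> (D *\<^sub>v v) = (v \<bullet> (C *\<^sub>v v) - x * (v \<bullet> v)) / (1 - x)"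
      unfolding D_def scalar_prod_contract_to_one[OF C(1) v] y(1)
      by (simp add: y(2) diff_divide_distrib)
    ultimately show ?thesis using x by simp
  qed
  moreover have "D $$ (i, i) = 1" if "i < n" for i
    using C that by (simp add: D_def contract_to_one_index)
  ultimately have "D \<in> elliptope n"
    using D by (simp add: elliptope_def positive_semidefinite_def)
  moreover have "contract_to_one x n D = C"
  proof (rule eq_matI)
    fix i j assume "i < dim_row C" "j < dim_col C"
    then have "i < n" "j < n" using C by auto
    then show "contract_to_one x n D $$ (i, j) = C $$ (i, j)"
      using C(1) D(1) x
      by (simp add: contract_to_one_index D_def y(1) distrib_left y')
  qed (use C D in \<open>auto simp: contract_to_one_def\<close>)
  ultimately show "C \<in> contract_to_one x n ` elliptope n" by blast
next
  fix C assume "C \<in> contract_to_one x n ` elliptope n"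
  then obtain D where D: "D \<in> carrier_mat n n" "transpose_mat D = D"
      "\<And>v. v \<in> carrier_vec n \<Longrightarrow> 0 \<le> v \<bullet> (D *\<^sub>v v)" "\<And>i. i < n \<Longrightarrow> D $$ (i, i) = 1"
    and C: "C = contract_to_one x n D"
    by (auto simp: elliptope_def positive_semidefinite_def)
  have C': "C \<in> carrier_mat n n" "transpose_mat C = C"
    using D by (auto simp: C symmetric_contract_to_one)
  have q: "x * (v \<bullet> v) \<le> v \<bullet> (C *\<^sub>v v)" if "v \<in> carrier_vec n" for v
    using D(1,3) that x by (simp add: C scalar_prod_contract_to_one)
  \<comment> \<open>Here \<open>0 \<le> x\<close> keeps the contracted matrix inside the
    elliptope.\<close>
  then have "0 \<le> v \<bullet> (C *\<^sub>v v)" if "v \<in> carrier_vec n" for v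
    using x scalar_prod_self_nonneg[of v] that by (meson mult_nonneg_nonneg order_trans)
  moreover have "C $$ (i, i) = 1" if "i < n" for i
    using D that by (simp add: C contract_to_one_index)
  ultimately show "C \<in> {C \<in> elliptope n. x \<le> min_eigenvalue C}"
    using C' q min_eigenvalue_ge_iff[OF C' n] by (simp add: elliptope_def positive_semidefinite_def)
qed

lemma offdiag_coords_contract_to_one:
  assumes "C \<in> carrier_mat n n"
  shows "offdiag_coords n (contract_to_one x n C)
    = (\<lambda>p\<in>offdiag_index n. (1 - x) * offdiag_coords n C p)"
  using assms by (auto simp: offdiag_coords_def offdiag_index_def contract_to_one_index fun_eq_iff)

text \<open>Treats \<open>x = 1\<close> separately, where the ratio is 0 and the contraction has no
  inverse: the set collapses to a point.\<close>

lemma elliptope_min_eigenvalue_ge_1: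
  assumes n: "n > 0" and C: "C \<in> elliptope n" "1 \<le> min_eigenvalue C"
  shows "offdiag_coords n C = (\<lambda>p\<in>offdiag_index n. 0)"
proof -
  have C': "C \<in> carrier_mat n n" "transpose_mat C = C" "\<And>i. i < n \<Longrightarrow> C $$ (i, i) = 1"
    using C by (auto simp: elliptope_def)
  have "C $$ (i, j) = 0" if ij: "i < j" "j < n" for i j
  proof -
    \<comment> \<open>\<open>C - 1\<close> is positive semidefinite with zero diagonal; test it on \<open>e\<^sub>i \<plusminus> e\<^sub>j\<close>\<close>
    define u where "u s = unit_vec n i + s \<cdot>\<^sub>v (unit_vec n j :: real vec)" for s :: real
    have i: "i < n" using ij by simp
    have u: "u s \<in> carrier_vec n" for s by (simp add: u_def)
    have sym: "C $$ (j, i) = C $$ (i, j)"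
      using C' i ij by (metis carrier_matD index_transpose_mat(1))
    have entry: "unit_vec n k \<bullet> (C *\<^sub>v unit_vec n l) = C $$ (k, l)" if "k < n" "l < n" for k l
      using that C'(1) by (simp add: scalar_prod_left_unit scalar_prod_right_unit)
    have uu: "u s \<bullet> u s = 1 + s * s" for s
      using ij i
      by (simp add: u_def scalar_prod_add_distrib[of _ n] add_scalar_prod_distrib[of _ n])
    have uCu: "u s \<bullet> (C *\<^sub>v u s) = 1 + s * s + 2 * s * C $$ (i, j)" for s
    proof -
      have "C *\<^sub>v u s = C *\<^sub>v unit_vec n i + s \<cdot>\<^sub>v (C *\<^sub>v unit_vec n j)"
        using C'(1) by (simp add: u_def mult_add_distrib_mat_vec mult_mat_vec)
      then show ?thesis
        using C'(1,3) ij i entry sym unfolding u_def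
        by (simp add: scalar_prod_add_distrib[of _ n] add_scalar_prod_distrib[of _ n] algebra_simps)
    qed
    have "1 * (u s \<bullet> u s) \<le> u s \<bullet> (C *\<^sub>v u s)" for s
      using min_eigenvalue_ge_iff[OF C'(1,2) n] C(2) u by blast
    \<comment> \<open>The sign \<open>s = 1\<close> gives that the entry is at least 0, and
      \<open>s = -1\<close> that it is at most 0.\<close>
    from this[of 1] this[of "-1"] show ?thesis
      by (simp add: uu uCu)
  qed
  then show ?thesis
    by (auto simp: offdiag_coords_def offdiag_index_def)
qed

section \<open>Scaling in a completed product of Lebesgue measures\<close>

text \<open>A completed measurable set is a measurable set together with part of a null set. The
  scaling rule sends null sets to null sets, so the image decomposes in the same way.\<close>

lemma completion_image:
  assumes f: "\<And>A. A \<in> sets M \<Longrightarrow> f ` A \<in> sets M"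
    and k: "\<And>A. A \<in> sets M \<Longrightarrow> emeasure M (f ` A) = k * emeasure M A"
    and A: "A \<in> sets (completion M)"
  shows "f ` A \<in> sets (completion M)" (is ?mem)
    and "emeasure (completion M) (f ` A) = k * emeasure (completion M) A" (is ?eq)
proof -
  obtain S N N' where *: "A = S \<union> N" "N \<subseteq> N'" "N' \<in> null_sets M" "S \<in> sets M"
    using sets_completionE[OF A] .
  have N': "f ` N' \<in> null_sets M"
    using *(3) f k by (auto simp: null_sets_def)
  have N: "N \<in> null_sets (completion M)" "f ` N \<in> null_sets (completion M)"
    unfolding null_sets_completion_iff2 using *(2,3) N' by (blast, blast)
  have fS: "f ` S \<in> sets (completion M)" "S \<in> sets (completion M)"
    using *(4) f by auto
  have img: "f ` A = f ` S \<union> f ` N" using *(1) by auto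
  show ?mem unfolding img using fS N by blast
  have "emeasure (completion M) (f ` A) = emeasure M (f ` S)"
    unfolding img using emeasure_Un_null_set[OF fS(1) N(2)] *(4) f by simp
  also have "\<dots> = k * emeasure M S" using *(4) k by simp
  also have "emeasure M S = emeasure (completion M) A"
    unfolding *(1) using emeasure_Un_null_set[OF fS(2) N(1)] *(4) by simp
  finally show ?eq .
qed

section \<open>Homotheties of a finite power of Lebesgue measure\<close>

context
  fixes I :: "'i set" and M :: "('i \<Rightarrow> real) measure" and s :: "real \<Rightarrow> ('i \<Rightarrow> real) \<Rightarrow> 'i \<Rightarrow> real"
  assumes fin: "finite I"
  defines "M \<equiv> Pi\<^sub>M I (\<lambda>_. lborel)"
    and "s \<equiv> \<lambda>c f. \<lambda>i\<in>I. c * f i"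
begin

private lemma measurable_scale: "s c \<in> M \<rightarrow>\<^sub>M M"
  unfolding s_def M_def by measurable

private lemma scale_inverse:
  assumes "c \<noteq> 0" "f \<in> space M"
  shows "s (inverse c) (s c f) = f"
  using assms by (auto simp: s_def M_def space_PiM PiE_def extensional_def fun_eq_iff)

text \<open>Turns images into preimages, to which measurability of the scaling applies.\<close>

private lemma scale_image_eq:
  assumes "c \<noteq> 0" "A \<subseteq> space M"
  shows "s c ` A = s (inverse c) -` A \<inter> space M"
proof (intro equalityI subsetI)
  fix g assume "g \<in> s c ` A"
  then obtain f where "f \<in> A" "g = s c f" by blast
  then show "g \<in> s (inverse c) -` A \<inter> space M"
    using assms scale_inverse[of c f] measurable_space[OF measurable_scale] by auto
next
  fix g assume "g \<in> s (inverse c) -` A \<inter> space M"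
  then show "g \<in> s c ` A"
    using assms scale_inverse[of "inverse c" g] by (metis IntE image_eqI inverse_inverse_eq
        nonzero_imp_inverse_nonzero vimageE)
qed

private lemma emeasure_lborel_scale_vimage:
  assumes c: "c > 0" and A: "A \<in> sets (borel :: real measure)"
  shows "ennreal c * emeasure lborel ((*) c -` A) = emeasure lborel A"
proof -
  have "emeasure lborel ((*) c -` A) = emeasure (distr lborel borel ((*) c)) A"
    using A by (simp add: emeasure_distr)
  also have "\<dots> = emeasure (density lborel (\<lambda>_. ennreal (inverse c))) A"
    using c by (simp add: lborel_distr_mult)
  also have "\<dots> = ennreal (inverse c) * emeasure lborel A"
    using A by (simp add: emeasure_density_const)
  finally show ?thesis
    using c by (simp add: mult.assoc[symmetric] ennreal_mult[symmetric])
qed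

text \<open>The product measure is determined by its values on boxes. The preimage of a box is a
  box, and \<open>c ^ card I\<close> supplies one factor \<open>c\<close> for each side.\<close>

private lemma scale_distr_eq:
  assumes c: "c > 0"
  shows "scale_measure (ennreal (c ^ card I)) (distr M M (s c)) = M"
proof -
  interpret product_sigma_finite "\<lambda>_ :: 'i. lborel :: real measure" ..
  show ?thesis
    unfolding M_def
  proof (rule PiM_eqI[OF fin], goal_cases)
    case 1
    show ?case by simp
  next
    case (2 A)
    then have A: "\<And>i. i \<in> I \<Longrightarrow> A i \<in> sets borel" by simp
    have vim: "s c -` Pi\<^sub>E I A \<inter> space M = Pi\<^sub>E I (\<lambda>i. (*) c -` A i)"
      by (auto simp: s_def M_def space_PiM PiE_def Pi_def)
    have meas: "(*) c -` A i \<in> sets borel" if "i \<in> I" for i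
      using measurable_sets_borel[of "(*) c" borel "A i"] A[OF that] by simp
    have "emeasure (distr M M (s c)) (Pi\<^sub>E I A) = emeasure M (Pi\<^sub>E I (\<lambda>i. (*) c -` A i))"
      using measurable_scale A fin vim
      by (subst emeasure_distr) (auto simp: M_def intro!: sets_PiM_I_finite)
    also have "\<dots> = (\<Prod>i\<in>I. emeasure lborel ((*) c -` A i))"
      unfolding M_def using meas by (intro emeasure_PiM fin) auto
    finally have "ennreal (c ^ card I) * emeasure (distr M M (s c)) (Pi\<^sub>E I A)
        = (\<Prod>i\<in>I. ennreal c * emeasure lborel ((*) c -` A i))"
      using c by (simp add: prod.distrib ennreal_power)
    also have "\<dots> = (\<Prod>i\<in>I. emeasure lborel (A i))"
      using c A by (intro prod.cong) (auto simp: emeasure_lborel_scale_vimage)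
    finally show ?case by (simp add: M_def)
  qed
qed

private lemma emeasure_scale_image:
  assumes c: "c > 0" and A: "A \<in> sets M"
  shows "s c ` A \<in> sets M" "emeasure M (s c ` A) = ennreal (c ^ card I) * emeasure M A"
proof -
  have eq: "s c ` A = s (inverse c) -` A \<inter> space M"
    using c sets.sets_into_space[OF A] by (intro scale_image_eq) auto
  then show "s c ` A \<in> sets M"
    using measurable_sets[OF measurable_scale A] by simp
  \<comment> \<open>The image under \<open>s c\<close> is a preimage under
    \<open>s (inverse c)\<close>, so the pushforward identity is applied with ratio
    \<open>inverse c\<close>.\<close>
  have "emeasure M A = ennreal (inverse c ^ card I) * emeasure (distr M M (s (inverse c))) A"
    using arg_cong[OF scale_distr_eq[of "inverse c"], of "\<lambda>N. emeasure N A"] c by simp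
  also have "\<dots> = ennreal (inverse c ^ card I) * emeasure M (s c ` A)"
    using emeasure_distr[OF measurable_scale A] eq by simp
  finally show "emeasure M (s c ` A) = ennreal (c ^ card I) * emeasure M A"
    using c by (simp add: mult.assoc[symmetric] ennreal_mult[symmetric] power_mult_distrib[symmetric])
qed

text \<open>Covers arbitrary subsets of the space, so that the elliptope need not be shown
  measurable: for a set that is not measurable, both sides are 0 by the convention of
  \<open>emeasure\<close>.\<close>

lemma emeasure_completion_scale_image:
  assumes c: "c > 0" and A: "A \<subseteq> space M"
  shows "emeasure (completion M) (s c ` A) = ennreal (c ^ card I) * emeasure (completion M) A"
proof (cases "A \<in> sets (completion M)")
  case True
  show ?thesis
    using completion_image(2)[OF emeasure_scale_image[OF c] True] .
next
  case False
  have "s (inverse c) ` (s c ` A) = (\<lambda>f. f) ` A"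
    unfolding image_image using c A scale_inverse[of c] by (intro image_cong) auto
  then have "s (inverse c) ` (s c ` A) = A" by simp
  \<comment> \<open>Were the image measurable, scaling back by \<open>inverse c\<close> would make
    \<open>A\<close> measurable.\<close>
  then have "s c ` A \<notin> sets (completion M)"
    using completion_image(1)[OF emeasure_scale_image[of "inverse c"]] c False
    by (metis inverse_positive_iff_positive)
  with False show ?thesis
    by (simp add: emeasure_notin_sets)
qed

end

section \<open>Number of coordinates and the volume identity\<close>

lemma finite_offdiag_index [simp]: "finite (offdiag_index n)"
proof (rule Finite_Set.finite_subset)
  show "offdiag_index n \<subseteq> {..<n} \<times> {..<n}"
    by (auto simp: offdiag_index_def)
qed simp

lemma card_offdiag_index: "card (offdiag_index n) = n * (n - 1) div 2"
proof (induction n)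
  case 0
  then show ?case by (simp add: offdiag_index_def)
next
  case (Suc n)
  have eq: "offdiag_index (Suc n) = offdiag_index n \<union> (\<lambda>i. (i, n)) ` {..<n}"
    by (auto simp: offdiag_index_def less_Suc_eq)
  have "card (offdiag_index (Suc n)) = card (offdiag_index n) + card ((\<lambda>i. (i, n)) ` {..<n})"
    unfolding eq by (rule card_Un_disjoint, simp, simp) (auto simp: offdiag_index_def)
  also have "card ((\<lambda>i. (i, n)) ` {..<n}) = n"
    by (simp add: card_image inj_on_def)
  also have "card (offdiag_index n) = n * (n - 1) div 2"
    by (rule Suc)
  \<comment> \<open>Splitting off \<open>n = 0\<close> disposes of the truncated subtraction
    \<open>n - 1\<close>.\<close>
  also have "n * (n - 1) div 2 + n = Suc n * (Suc n - 1) div 2"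
    by (cases n) (auto simp: algebra_simps)
  finally show ?case .
qed

theorem theorem1:
  fixes n d :: nat and x :: real
  assumes "n \<ge> 2" and "d = n * (n - 1) div 2" and "x \<in> {0..1}"
  shows "Vol n {C \<in> elliptope n. min_eigenvalue C \<ge> x} = ennreal ((1 - x) ^ d) * Vol n (elliptope n)"
proof -
  let ?I = "offdiag_index n" and ?E = "elliptope n"
  let ?M = "Pi\<^sub>M ?I (\<lambda>_. lborel) :: (nat \<times> nat \<Rightarrow> real) measure"
  have n: "n > 0" and d: "d = card ?I"
    using assms by (auto simp: card_offdiag_index)
  show ?thesis
  proof (cases "x = 1")
    case False
    then have x: "0 \<le> x" "x < 1" using assms(3) by auto
    have "offdiag_coords n ` contract_to_one x n ` ?E
        = (\<lambda>f. \<lambda>p\<in>?I. (1 - x) * f p) ` offdiag_coords n ` ?E"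
      unfolding image_image
      by (intro image_cong) (auto simp: elliptope_def offdiag_coords_contract_to_one)
    moreover have "offdiag_coords n ` ?E \<subseteq> space ?M"
      by (auto simp: space_PiM offdiag_coords_def)
    ultimately show ?thesis
      unfolding Vol_def elliptope_min_eigenvalue_ge[OF n x] d
      using emeasure_completion_scale_image[OF finite_offdiag_index, of "1 - x"] x by simp
  next
    case True
    let ?O = "Pi\<^sub>E ?I (\<lambda>_. {0 :: real})"
    interpret product_sigma_finite "\<lambda>_ :: nat \<times> nat. lborel :: real measure" ..
    \<comment> \<open>By \<open>n \<ge> 2\<close> there is at least one coordinate. Hence the
      one-point box \<open>?O\<close> is null, and the factor \<open>0 ^ d\<close> on the right is 0
      rather than 1.\<close>
    have "(0, 1) \<in> ?I" using assms(1) by (auto simp: offdiag_index_def)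
    then have d0: "d > 0" unfolding d by (auto simp: card_gt_0_iff)
    have "emeasure ?M ?O = (\<Prod>i\<in>?I. emeasure lborel {0 :: real})"
      by (intro emeasure_PiM) auto
    also have "\<dots> = 0" using d0 d by simp
    finally have "emeasure ?M ?O = 0" .
    moreover have "?O \<in> sets ?M"
      by (intro sets_PiM_I_finite) auto
    ultimately have "?O \<in> null_sets ?M"
      by (simp add: null_sets_def del: PiE_singleton)
    moreover have "offdiag_coords n ` {C \<in> ?E. 1 \<le> min_eigenvalue C} \<subseteq> ?O"
      using elliptope_min_eigenvalue_ge_1[OF n] by auto
    ultimately have "offdiag_coords n ` {C \<in> ?E. 1 \<le> min_eigenvalue C} \<in> null_sets (completion ?M)"
      unfolding null_sets_completion_iff2 by blast
    then show ?thesis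
      using True d0 by (simp add: Vol_def null_sets_def)
  qed
qed

end
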